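(* Let $G$ be a finite abelian group (written additively) and let $H$ be a cyclic subgroup of $G$ of order $n$, with a fixed generator $g$, so that $H=\{0,g,2g,\ldots,(n-1)g\}$ is identified with $\mathbb{Z}_n=\{0,1,\ldots,n-1\}$ via $kg\leftrightarrow k$. Let $J\subset H$ satisfy $J\cap(-J)=\{0\}$. Suppose $h(t)\in\mathbb{Z}[t]$ is a polynomial with $h(0)=1$ such that the coefficient of $t^k$ in $h(t)$ is nonzero only if $k\in J$ (regarding $J$ as a subset of $\{0,1,\ldots,n-1\}$ via the identification above). Then for every positive integer $N$, $$D_G(J,N)\le [G:H]^N\cdot \#\Big\{(v_1,\ldots,v_N)\in\mathbb{Z}_n^N:\ \Re\Big(\prod_{j=1}^N h\big(e_n(v_j)\big)\Big)\ge 1\Big\}.$$ In particular, if moreover $h(t)$ divides $t^n-1$, then $$D_G(J,N)\le \big(|G|-\deg(h)\,[G:H]\big)^N.$$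
   Context: For a finite abelian group $G$, a subset $J\subset G$ with $0\in J$, and a positive integer $N$, $D_G(J,N)$ denotes the maximum size of a set $A\subset G^N$ such that $(A-A)\cap J^N=\{\mathbf{0}\}$, where $G^N$, $J^N$ are $N$-fold Cartesian products and $A-A=\{x-y:x,y\in A\}$. For $x\in\mathbb{Z}_n$ (viewed as an integer in $\{0,\ldots,n-1\}$), $e_n(x)=\exp(2\pi i x/n)$. $\Re(z)$ is the real part of $z$, and $[G:H]$ is the index of $H$ in $G$. *)

theory Defs
  imports "HOL-Analysis.Analysis" "HOL-Algebra.Product_Groups"
    "HOL-Computational_Algebra.Polynomial"
begin

text \<open>
  Abelian groups are those of HOL-Algebra, hence written multiplicatively: the difference
  \<open>x - y\<close>, the set \<open>-J\<close> and the multiple \<open>k g\<close> of the additive notation are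
  \<open>x \<otimes> inv y\<close>, \<open>set_inv J\<close> and \<open>g [^] k\<close>.
  Elements of an \<open>N\<close>-fold Cartesian power are the extensional functions on \<open>{..<N}\<close>.
\<close>

abbreviation group_power :: "('a, 'b) monoid_scheme \<Rightarrow> nat \<Rightarrow> (nat \<Rightarrow> 'a) monoid"
  where "group_power G N \<equiv> product_group {..<N} (\<lambda>_. G)"

definition set_power :: "'a set \<Rightarrow> nat \<Rightarrow> (nat \<Rightarrow> 'a) set"
  where "set_power S N = (\<Pi>\<^sub>E j\<in>{..<N}. S)"

definition difference_set :: "('a, 'b) monoid_scheme \<Rightarrow> 'a set \<Rightarrow> 'a set"
  where "difference_set G A = {x \<otimes>\<^bsub>G\<^esub> inv\<^bsub>G\<^esub> y | x y. x \<in> A \<and> y \<in> A}"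

text \<open>
  Only meant for finite \<open>G\<close> and \<open>J\<close> containing the neutral element; then the singletons are
  admissible and the maximum is attained. The empty set is not admissible.
\<close>

definition D :: "('a, 'b) monoid_scheme \<Rightarrow> 'a set \<Rightarrow> nat \<Rightarrow> nat"
  where "D G J N = Max {card A | A. A \<subseteq> carrier (group_power G N) \<and>
    difference_set (group_power G N) A \<inter> set_power J N = {\<one>\<^bsub>group_power G N\<^esub>}}"

definition subgroup_index :: "('a, 'b) monoid_scheme \<Rightarrow> 'a set \<Rightarrow> nat"
  where "subgroup_index G H = card (rcosets\<^bsub>G\<^esub> H)"

definition e :: "nat \<Rightarrow> nat \<Rightarrow> complex"
  where "e n x = exp (2 * of_real pi * \<i> * of_nat x / of_nat n)"

definition ceval :: "int poly \<Rightarrow> complex \<Rightarrow> complex"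
  where "ceval h z = poly (map_poly of_int h) z"

end

(*
  Splitting A into cosets of H^N, it suffices to bound a set B of exponent vectors modulo n.
  Put F(v) = prod_j h(e_n(v_j)). By Fourier inversion on Z_n^N and the hypothesis on B, the
  functions u on B satisfy  sum_v F(v) |u^(v)|^2 = n^N ||u||^2,  and Parseval says the same with
  F replaced by 1. If fewer than |B| vectors v had Re F(v) >= 1, some nonzero u would have a
  transform vanishing at all of them; comparing real parts of the two identities, u^ = 0
  everywhere, a contradiction. If h divides t^n - 1, then h vanishes at deg h of the n-th roots
  of unity, and F(v) is nonzero only if every v_j avoids them.
*)

theory Submission
  imports Defs "HOL-Algebra.Multiplicative_Group"
begin

section \<open>Homogeneous linear systems over a field\<close>

text \<open>Gaussian elimination, by induction on the equations: solving equation \<open>s\<close>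
  for a pivot unknown \<open>p\<close> removes one equation and one unknown. If row \<open>s\<close>
  is zero, it can simply be dropped.\<close>

lemma underdetermined_linear_system:
  fixes m :: "'s \<Rightarrow> 'i \<Rightarrow> 'f::field"
  assumes "finite S" and "finite I" and "card S < card I"
  shows "\<exists>u. (\<exists>i\<in>I. u i \<noteq> 0) \<and> (\<forall>s\<in>S. (\<Sum>i\<in>I. m s i * u i) = 0)"
  using assms
proof (induction S arbitrary: I m rule: finite_induct)
  case empty
  then have "I \<noteq> {}" by auto
  then show ?case by (intro exI[of _ "\<lambda>_. 1"]) auto
next
  case (insert s S)
  show ?case
  proof (cases "\<forall>i\<in>I. m s i = 0")
    case True
    from insert obtain u where "\<exists>i\<in>I. u i \<noteq> 0" "\<forall>t\<in>S. (\<Sum>i\<in>I. m t i * u i) = 0"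
      by (metis card_insert_disjoint Suc_lessD)
    with True show ?thesis by (intro exI[of _ u]) auto
  next
    case False
    then obtain p where p: "p \<in> I" "m s p \<noteq> 0" by auto
    have "card S < card (I - {p})"
      using insert.prems insert.hyps p by simp
    \<comment> \<open>The reduced system consists of the rows of \<open>S\<close> after subtracting
      the multiple of row \<open>s\<close> that clears column \<open>p\<close>.\<close>
    then obtain u where u: "\<exists>i\<in>I - {p}. u i \<noteq> 0"
      and 0: "\<And>t. t \<in> S \<Longrightarrow> (\<Sum>i\<in>I - {p}. (m t i - m t p / m s p * m s i) * u i) = 0"
      using insert.IH[of "I - {p}" "\<lambda>t i. m t i - m t p / m s p * m s i"] insert.prems(1) by auto
    define T where "T t = (\<Sum>i\<in>I - {p}. m t i * u i)" for t
    \<comment> \<open>The pivot entry is the value that makes row \<open>s\<close> vanish: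
      \<open>T s + m s p * w p = 0\<close>.\<close>
    define w where "w = u(p := - T s / m s p)"
    have T: "(\<Sum>i\<in>I. m t i * w i) = T t - m t p / m s p * T s" for t
    proof -
      have "(\<Sum>i\<in>I. m t i * w i) = m t p * w p + (\<Sum>i\<in>I - {p}. m t i * w i)"
        using insert.prems(1) p(1) by (simp add: sum.remove)
      also have "(\<Sum>i\<in>I - {p}. m t i * w i) = T t"
        unfolding T_def w_def by (intro sum.cong) auto
      finally show ?thesis by (simp add: w_def)
    qed
    have "T t - m t p / m s p * T s = 0" if "t \<in> S" for t
      using 0[OF that] by (simp add: T_def left_diff_distrib sum_subtractf sum_distrib_left mult.assoc)
    moreover have "T s - m s p / m s p * T s = 0"
      using p(2) by simp
    moreover have "\<exists>i\<in>I. w i \<noteq> 0"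
      using u by (auto simp: w_def)
    ultimately show ?thesis
      using T by (intro exI[of _ w]) auto
  qed
qed

section \<open>Roots of unity and Fourier inversion modulo n\<close>

lemma e_mult: "e n (x * y) = e n x ^ y"
  by (simp add: e_def exp_of_nat_mult[symmetric] mult_ac)

lemma e_power_modulus: "n > 0 \<Longrightarrow> e n x ^ n = 1"
  using complex_root_unity[of n x] by (simp add: e_def)

lemma e_eq_1_iff: "n > 0 \<Longrightarrow> e n x = 1 \<longleftrightarrow> n dvd x"
  using complex_root_unity_eq_1[of n x] by (simp add: e_def)

lemma inj_on_e: "n > 0 \<Longrightarrow> inj_on (e n) {..<n}"
  by (auto simp: e_def inj_on_def complex_root_unity_eq)

lemma norm_e: "norm (e n x) = 1"
  by (simp add: e_def norm_exp_eq_Re)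

text \<open>Both sides are inverse to \<open>e n v ^ a\<close>. Writing the conjugate as a natural
  power lets a product of characters collapse into a single power of \<open>e n v\<close>.\<close>

lemma cnj_e_mult:
  assumes "n > 0" and "a \<le> n"
  shows "cnj (e n (v * a)) = e n v ^ (n - a)"
proof -
  have "e n v ^ a * e n v ^ (n - a) = 1"
    using assms by (simp add: power_add[symmetric] e_power_modulus)
  moreover have "cnj (e n (v * a)) * e n v ^ a = 1"
    using complex_norm_square[of "e n (v * a)"] by (simp add: norm_e mult.commute flip: e_mult)
  ultimately show ?thesis
    by (metis mult.assoc mult_1_left mult_1_right)
qed

text \<open>As \<open>e n v ^ m = e n m ^ v\<close>, this is a geometric sum with ratio
  \<open>e n m\<close>, which is 1 exactly when \<open>n dvd m\<close>.\<close>

lemma sum_e_power: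
  assumes "n > 0"
  shows "(\<Sum>v<n. e n v ^ m) = (if n dvd m then of_nat n else 0)"
proof -
  have "(\<Sum>v<n. e n v ^ m) = (\<Sum>v<n. e n m ^ v)"
    by (simp add: e_mult[symmetric] mult.commute)
  then show ?thesis
    using assms e_power_modulus[OF assms, of m] e_eq_1_iff[OF assms, of m]
    by (auto simp: geometric_sum)
qed

text \<open>The value at \<open>a - b\<close> of the inverse Fourier transform on \<open>\<int>\<^sub>n\<close>.\<close>

lemma sum_poly_e:
  fixes p :: "complex poly"
  assumes n: "n > 0" and deg: "Polynomial.degree p < n" and ab: "a < n" "b < n"
  shows "(\<Sum>v<n. poly p (e n v) * cnj (e n (v * a)) * e n (v * b)) =
    of_nat n * Polynomial.coeff p ((a + n - b) mod n)"
proof -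
  \<comment> \<open>Adding \<open>n\<close> first keeps the natural subtraction from truncating, so
    \<open>d\<close> is the residue of the integer difference of \<open>a\<close> and
    \<open>b\<close>.\<close>
  define d where "d = (a + n - b) mod n"
  have "int d = (int a - int b + int n) mod int n"
    using ab by (simp add: d_def of_nat_diff zmod_int algebra_simps)
  then have d_int: "int d = (int a - int b) mod int n" by simp
  \<comment> \<open>The exponent is what the monomial of degree \<open>k\<close> acquires from the
    two characters. By orthogonality only \<open>k = d\<close> survives; since the degree of
    \<open>p\<close> is below \<open>n\<close>, no two monomials share a residue.\<close>
  have d: "n dvd k + (n - a) + b \<longleftrightarrow> k = d" if "k < n" for k
  proof -
    have "n dvd k + (n - a) + b \<longleftrightarrow> int n dvd (int k - (int a - int b)) + int n"
      unfolding int_dvd_int_iff[symmetric] using ab by (simp add: of_nat_diff algebra_simps)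
    also have "\<dots> \<longleftrightarrow> int k mod int n = (int a - int b) mod int n"
      by (simp add: mod_eq_dvd_iff)
    also have "\<dots> \<longleftrightarrow> k = d"
      unfolding d_int[symmetric] using that by simp
    finally show ?thesis .
  qed
  have "d < n" using n by (simp add: d_def)
  have "poly p z = (\<Sum>k<n. Polynomial.coeff p k * z ^ k)" for z
    unfolding poly_altdef using deg
    by (intro sum.mono_neutral_left) (auto simp: coeff_eq_0)
  then have "(\<Sum>v<n. poly p (e n v) * cnj (e n (v * a)) * e n (v * b)) =
      (\<Sum>v<n. \<Sum>k<n. Polynomial.coeff p k * e n v ^ (k + (n - a) + b))"
    unfolding cnj_e_mult[OF n less_imp_le[OF ab(1)]] unfolding e_mult
    by (simp only: power_add sum_distrib_right mult.assoc)
  also have "\<dots> = (\<Sum>k<n. Polynomial.coeff p k * (\<Sum>v<n. e n v ^ (k + (n - a) + b)))"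
    by (subst sum.swap) (simp add: sum_distrib_left)
  also have "\<dots> = (\<Sum>k<n. if k = d then of_nat n * Polynomial.coeff p d else 0)"
    using d by (intro sum.cong) (auto simp: sum_e_power[OF n])
  also have "\<dots> = of_nat n * Polynomial.coeff p d"
    using \<open>d < n\<close> by simp
  finally show ?thesis by (simp add: d_def)
qed


text \<open>The summand is a product over the coordinates, so the sum over the N-fold power factors
  into N one-dimensional inversions.\<close>

lemma sum_prod_poly_e:
  fixes p :: "complex poly"
  assumes "n > 0" and "Polynomial.degree p < n"
    and "\<And>j. j < N \<Longrightarrow> x j < n" and "\<And>j. j < N \<Longrightarrow> y j < n"
  shows "(\<Sum>v\<in>set_power {..<n} N. (\<Prod>j<N. poly p (e n (v j))) *
      cnj (\<Prod>j<N. e n (v j * x j)) * (\<Prod>j<N. e n (v j * y j))) =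
    of_nat n ^ N * (\<Prod>j<N. Polynomial.coeff p ((x j + n - y j) mod n))"
proof -
  have "(\<Sum>v\<in>set_power {..<n} N. (\<Prod>j<N. poly p (e n (v j))) *
      cnj (\<Prod>j<N. e n (v j * x j)) * (\<Prod>j<N. e n (v j * y j))) =
    (\<Prod>j<N. \<Sum>w<n. poly p (e n w) * cnj (e n (w * x j)) * e n (w * y j))"
    by (simp add: prod_sum_PiE set_power_def prod.distrib)
  also have "\<dots> = (\<Prod>j<N. of_nat n * Polynomial.coeff p ((x j + n - y j) mod n))"
    using assms by (intro prod.cong refl sum_poly_e) auto
  finally show ?thesis by (simp add: prod.distrib)
qed

section \<open>The weighted quadratic form of the transform\<close>

text \<open>Expanding the square and summing over \<open>v\<close> first, the pair \<open>x\<close>,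
  \<open>y\<close> receives a product of coefficients of \<open>p\<close> at the differences of
  exponents. By \<open>off\<close> it vanishes for distinct \<open>x\<close> and \<open>y\<close>,
  and by \<open>p0\<close> it is 1 on the diagonal. Taking 1 for \<open>p\<close> gives Parseval's
  identity.\<close>

lemma quadratic_form_diagonal:
  fixes p :: "complex poly" and k :: "'b \<Rightarrow> nat \<Rightarrow> nat" and u :: "'b \<Rightarrow> complex"
  assumes "n > 0" and "Polynomial.degree p < n" and p0: "Polynomial.coeff p 0 = 1" and "finite B"
    and k: "\<And>x j. x \<in> B \<Longrightarrow> j < N \<Longrightarrow> k x j < n"
    and off: "\<And>x y. x \<in> B \<Longrightarrow> y \<in> B \<Longrightarrow> x \<noteq> y \<Longrightarrow>
      \<exists>j<N. Polynomial.coeff p ((k x j + n - k y j) mod n) = 0"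
  shows "(\<Sum>v\<in>set_power {..<n} N. (\<Prod>j<N. poly p (e n (v j))) *
      of_real ((cmod (\<Sum>x\<in>B. cnj (\<Prod>j<N. e n (v j * k x j)) * u x))\<^sup>2)) =
    of_real (of_nat n ^ N * (\<Sum>x\<in>B. (cmod (u x))\<^sup>2))"
proof -
  define F where "F v = (\<Prod>j<N. poly p (e n (v j)))" for v
  define chi where "chi v x = (\<Prod>j<N. e n (v j * k x j))" for v x
  have coeffs: "(\<Prod>j<N. Polynomial.coeff p ((k x j + n - k y j) mod n)) = (if x = y then 1 else 0)"
    if "x \<in> B" "y \<in> B" for x y
    using off[OF that] p0 by (auto simp: prod_zero_iff)
  have kernel: "(\<Sum>v\<in>set_power {..<n} N. F v * cnj (chi v x) * chi v y) =
      of_nat n ^ N * (if x = y then 1 else 0)" if "x \<in> B" "y \<in> B" for x y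
    using sum_prod_poly_e[OF assms(1,2), of N "k x" "k y"] k that
    by (simp add: F_def chi_def coeffs[OF that])
  have norm_sq: "of_real ((cmod (\<Sum>x\<in>B. cnj (chi v x) * u x))\<^sup>2) =
      (\<Sum>x\<in>B. \<Sum>y\<in>B. (cnj (chi v x) * u x) * (chi v y * cnj (u y)))" for v
  proof -
    have "cnj (\<Sum>x\<in>B. cnj (chi v x) * u x) = (\<Sum>y\<in>B. chi v y * cnj (u y))" by simp
    then show ?thesis unfolding complex_norm_square by (simp only: sum_product)
  qed
  have "(\<Sum>v\<in>set_power {..<n} N. F v * of_real ((cmod (\<Sum>x\<in>B. cnj (chi v x) * u x))\<^sup>2)) =
      (\<Sum>v\<in>set_power {..<n} N. \<Sum>x\<in>B. \<Sum>y\<in>B.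
        u x * cnj (u y) * (F v * cnj (chi v x) * chi v y))"
    unfolding norm_sq sum_distrib_left by (intro sum.cong refl) (simp only: mult_ac)
  also have "\<dots> = (\<Sum>x\<in>B. \<Sum>y\<in>B. \<Sum>v\<in>set_power {..<n} N.
        u x * cnj (u y) * (F v * cnj (chi v x) * chi v y))"
    by (rule trans[OF sum.swap]) (rule sum.cong[OF refl], rule sum.swap)
  also have "\<dots> = (\<Sum>x\<in>B. \<Sum>y\<in>B. u x * cnj (u y) * (of_nat n ^ N * (if x = y then 1 else 0)))"
    by (intro sum.cong refl) (simp only: sum_distrib_left[symmetric] kernel)
  also have "\<dots> = (\<Sum>x\<in>B. \<Sum>y\<in>B. if x = y then of_nat n ^ N * (u x * cnj (u x)) else 0)"
    by (intro sum.cong refl) auto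
  also have "\<dots> = (\<Sum>x\<in>B. of_nat n ^ N * (u x * cnj (u x)))"
    using \<open>finite B\<close> by simp
  also have "\<dots> = of_real (of_nat n ^ N * (\<Sum>x\<in>B. (cmod (u x))\<^sup>2))"
    by (simp only: of_real_mult of_real_sum complex_norm_square sum_distrib_left) simp
  finally show ?thesis by (simp only: F_def chi_def)
qed

text \<open>The dimension count. \<open>B\<close> is an abstract index set with exponent vectors
  \<open>k x\<close>, so that group elements can be inserted through their exponents relative to a
  base point.\<close>

lemma card_le_card_Re_ge_1:
  fixes p :: "complex poly" and k :: "'b \<Rightarrow> nat \<Rightarrow> nat"
  assumes "n > 0" and "Polynomial.degree p < n" and "Polynomial.coeff p 0 = 1" and "finite B"
    and "\<And>x j. x \<in> B \<Longrightarrow> j < N \<Longrightarrow> k x j < n"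
    and off: "\<And>x y. x \<in> B \<Longrightarrow> y \<in> B \<Longrightarrow> x \<noteq> y \<Longrightarrow>
      \<exists>j<N. Polynomial.coeff p ((k x j + n - k y j) mod n) = 0"
  shows "card B \<le> card {v \<in> set_power {..<n} N. Re (\<Prod>j<N. poly p (e n (v j))) \<ge> 1}"
proof (rule ccontr)
  define V where "V = set_power {..<n} N"
  define F where "F v = (\<Prod>j<N. poly p (e n (v j)))" for v
  define S where "S = {v \<in> V. Re (F v) \<ge> 1}"
  define chi where "chi v x = (\<Prod>j<N. e n (v j * k x j))" for v x
  assume "\<not> ?thesis"
  then have "card S < card B" by (simp add: S_def V_def F_def)
  have "finite V" by (simp add: V_def set_power_def finite_PiE)
  then have "finite S" by (simp add: S_def)
  \<comment> \<open>Each \<open>v\<close> in \<open>S\<close> imposes one linear equation on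
    \<open>u\<close>, namely that its transform vanish at \<open>v\<close>; there are fewer
    equations than unknowns.\<close>
  from underdetermined_linear_system[OF \<open>finite S\<close> \<open>finite B\<close> \<open>card S < card B\<close>,
      of "\<lambda>v x. cnj (chi v x)"]
  obtain u where nonzero: "\<exists>x\<in>B. u x \<noteq> 0"
    and vanish: "\<And>v. v \<in> S \<Longrightarrow> (\<Sum>x\<in>B. cnj (chi v x) * u x) = 0"
    by blast
  define U where "U v = (cmod (\<Sum>x\<in>B. cnj (chi v x) * u x))\<^sup>2" for v
  define T where "T = of_nat n ^ N * (\<Sum>x\<in>B. (cmod (u x))\<^sup>2)"
  have "(\<Sum>v\<in>V. F v * of_real (U v)) = of_real T"
    unfolding V_def F_def U_def T_def chi_def
    by (rule quadratic_form_diagonal) (use assms in auto)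
  then have F_sum: "(\<Sum>v\<in>V. Re (F v) * U v) = T"
    by (simp add: complex_eq_iff)
  \<comment> \<open>The condition \<open>off\<close> passes from \<open>p\<close> to the polynomial
    1: an index where \<open>p\<close> has coefficient 0 cannot be 0, because there the coefficient
    is 1.\<close>
  have "\<exists>j<N. Polynomial.coeff (1 :: complex poly) ((k x j + n - k y j) mod n) = 0"
    if xy: "x \<in> B" "y \<in> B" "x \<noteq> y" for x y
  proof -
    from off[OF xy] obtain j where j: "j < N" "Polynomial.coeff p ((k x j + n - k y j) mod n) = 0"
      by blast
    with assms(3) have "(k x j + n - k y j) mod n \<noteq> 0" by (metis zero_neq_one)
    with j show ?thesis by auto
  qed
  then have "(\<Sum>v\<in>V. (\<Prod>j<N. poly 1 (e n (v j))) * of_real (U v)) = of_real T"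
    unfolding V_def U_def T_def chi_def
    by (intro quadratic_form_diagonal) (use assms in auto)
  then have U_sum: "(\<Sum>v\<in>V. U v) = T"
    by (simp flip: of_real_sum)
  have U_zero: "U v = 0" if "v \<in> S" for v
    by (simp add: U_def vanish[OF that])
  \<comment> \<open>Every summand is nonnegative, since \<open>U\<close> vanishes on
    \<open>S\<close> and \<open>Re (F v) < 1\<close> outside it. Hence each summand is zero, and so
    is each \<open>U v\<close>.\<close>
  have "(\<Sum>v\<in>V. (1 - Re (F v)) * U v) = 0"
    by (simp add: left_diff_distrib sum_subtractf F_sum U_sum)
  moreover have "(1 - Re (F v)) * U v \<ge> 0" if "v \<in> V" for v
    using that U_zero[of v] by (cases "v \<in> S") (auto simp: S_def U_def)
  ultimately have zero: "(1 - Re (F v)) * U v = 0" if "v \<in> V" for v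
    using that \<open>finite V\<close> by (simp add: sum_nonneg_eq_0_iff)
  have "U v = 0" if "v \<in> V" for v
    using zero[OF that] that U_zero[of v] by (cases "v \<in> S") (auto simp: S_def)
  then have "T = 0" using U_sum by simp
  then have "\<forall>x\<in>B. u x = 0"
    using \<open>n > 0\<close> \<open>finite B\<close> by (simp add: T_def sum_nonneg_eq_0_iff)
  with nonzero show False by blast
qed

text \<open>The cofactor of \<open>p\<close> must vanish at every n-th root of unity where
  \<open>p\<close> does not, and it has at most \<open>n - degree p\<close> roots.\<close>

lemma card_nonzero_at_roots_of_unity:
  fixes p :: "complex poly"
  assumes "n > 0" and "p dvd Polynomial.monom 1 n - 1"
  shows "card {v \<in> {..<n}. poly p (e n v) \<noteq> 0} + Polynomial.degree p \<le> n"
proof -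
  from assms(2) obtain q where q: "Polynomial.monom 1 n - 1 = p * q" by (elim dvdE)
  have deg: "Polynomial.degree (Polynomial.monom 1 n - 1 :: complex poly) = n"
    using \<open>n > 0\<close> by (subst diff_conv_add_uminus, subst degree_add_eq_left) (auto simp: degree_monom_eq)
  then have "p * q \<noteq> 0" using \<open>n > 0\<close> q by auto
  then have nz: "p \<noteq> 0" "q \<noteq> 0" by auto
  have "poly q (e n v) = 0" if "poly p (e n v) \<noteq> 0" for v
  proof -
    have "poly p (e n v) * poly q (e n v) = 0"
      using arg_cong[OF q, of "\<lambda>r. poly r (e n v)"] \<open>n > 0\<close>
      by (simp add: poly_monom e_power_modulus)
    with that show ?thesis by simp
  qed
  then have "e n ` {v \<in> {..<n}. poly p (e n v) \<noteq> 0} \<subseteq> {z. poly q z = 0}" by auto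
  then have "card (e n ` {v \<in> {..<n}. poly p (e n v) \<noteq> 0}) \<le> card {z. poly q z = 0}"
    using nz by (intro card_mono) (auto simp: poly_roots_finite)
  also have "\<dots> \<le> Polynomial.degree q"
    using nz by (intro card_poly_roots_bound) auto
  finally have "card {v \<in> {..<n}. poly p (e n v) \<noteq> 0} \<le> Polynomial.degree q"
    by (subst (asm) card_image) (auto intro: inj_on_subset[OF inj_on_e[OF \<open>n > 0\<close>]])
  moreover have "Polynomial.degree p + Polynomial.degree q = n"
    using deg nz by (simp add: q degree_mult_eq)
  ultimately show ?thesis by simp
qed


section \<open>Difference-free sets and cosets of a cyclic subgroup\<close>

lemma (in group) pow_mod_ord:
  assumes "a \<in> carrier G"
  shows "a [^] (k mod ord a) = a [^] (k :: nat)"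
proof -
  have "a [^] k = a [^] (ord a * (k div ord a) + k mod ord a)" by simp
  also have "\<dots> = (a [^] ord a) [^] (k div ord a) \<otimes> a [^] (k mod ord a)"
    using assms by (simp only: nat_pow_mult nat_pow_pow)
  finally show ?thesis using assms by simp
qed

lemma (in group) finite_group_power:
  "finite (carrier G) \<Longrightarrow> finite (carrier (group_power G N))"
  by (simp add: finite_PiE)

text \<open>\<open>A\<close> splits into fibres over N-tuples of cosets of \<open>H\<close>. Inside
  one fibre all elements differ from a base point by powers of \<open>g\<close>, so the bound for
  exponent vectors applies to each fibre.\<close>

lemma (in group) card_difference_free_le:
  fixes p :: "complex poly"
  assumes fin: "finite (carrier G)" and g: "g \<in> carrier G"
    and H: "H = generate G {g}" "card H = n"
    and A: "A \<subseteq> carrier (group_power G N)"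
      "difference_set (group_power G N) A \<inter> set_power J N = {\<one>\<^bsub>group_power G N\<^esub>}"
    and p: "Polynomial.degree p < n" "Polynomial.coeff p 0 = 1"
      "\<And>k. k < n \<Longrightarrow> Polynomial.coeff p k \<noteq> 0 \<Longrightarrow> g [^] k \<in> J"
  shows "card A \<le> card (rcosets H) ^ N *
    card {v \<in> set_power {..<n} N. Re (\<Prod>j<N. poly p (e n (v j))) \<ge> 1}"
proof -
  have n: "ord g = n" using generate_pow_card[OF g] H by simp
  then have "n > 0" using ord_ge_1[OF fin g] by simp
  have "subgroup H G" using generate_is_subgroup[of "{g}"] g H by simp
  have H_pow: "\<exists>k<n. h = g [^] k" if "h \<in> H" for h
  proof -
    from that obtain m :: nat where "h = g [^] m"
      unfolding H generate_pow_on_finite_carrier[OF fin g] by blast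
    then have "h = g [^] (m mod n)" using pow_mod_ord[OF g] n by simp
    with \<open>n > 0\<close> show ?thesis by (metis mod_less_divisor)
  qed
  define phi where "phi x = (\<lambda>j\<in>{..<N}. H #> x j)" for x :: "nat \<Rightarrow> 'a"
  have x_carrier: "x j \<in> carrier G" if "x \<in> A" "j < N" for x j
    using A(1) that by auto
  have "finite A" using A(1) fin by (auto intro: finite_subset finite_PiE)
  have "finite (rcosets H)" using fin by (simp add: RCOSETS_def)
  then have fin_cosets: "finite (set_power (rcosets H) N)"
    by (simp add: set_power_def finite_PiE)
  have fibre: "card {x \<in> A. phi x = c} \<le>
    card {v \<in> set_power {..<n} N. Re (\<Prod>j<N. poly p (e n (v j))) \<ge> 1}" (is "card ?B \<le> ?M") for c
  proof (cases "?B = {}")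
    case False
    \<comment> \<open>The base point of the fibre. Cosets \<open>H #> r j\<close> put the power of
      \<open>g\<close> on the left, so \<open>r j\<close> cancels in
      \<open>x j \<otimes> inv y j\<close>.\<close>
    then obtain r where r: "r \<in> A" "phi r = c" by auto
    have ex: "\<exists>k<n. x j = g [^] k \<otimes> r j" if "x \<in> ?B" "j < N" for x j
    proof -
      have "phi x = phi r" using that(1) r(2) by auto
      then have "phi x j = phi r j" by (rule fun_cong)
      then have "H #> x j = H #> r j" using that(2) by (simp add: phi_def)
      then have "x j \<in> H #> r j"
        using rcos_self[OF _ \<open>subgroup H G\<close>, of "x j"] x_carrier that by auto
      then show ?thesis using H_pow by (auto simp: r_coset_def)
    qed
    define k where "k x j = (SOME m. m < n \<and> x j = g [^] m \<otimes> r j)" for x :: "nat \<Rightarrow> 'a" and j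
    have k: "k x j < n \<and> x j = g [^] k x j \<otimes> r j" if "x \<in> ?B" "j < N" for x j
      unfolding k_def using ex[OF that] by (rule someI_ex)
    show ?thesis
    proof (rule card_le_card_Re_ge_1[of n p _ _ k])
      show "\<exists>j<N. Polynomial.coeff p ((k x j + n - k y j) mod n) = 0"
        if xy: "x \<in> ?B" "y \<in> ?B" "x \<noteq> y" for x y
      proof (rule ccontr)
        \<comment> \<open>If all these coefficients were nonzero, every coordinate of the difference
          would lie in \<open>J\<close>; then the difference is the identity and
          \<open>x = y\<close>.\<close>
        assume contra: "\<not> ?thesis"
        have J: "x j \<otimes> inv y j \<in> J" if j: "j < N" for j
        proof -
          define m where "m = (k x j + n - k y j) mod n"
          \<comment> \<open>Adding \<open>k y j\<close> back undoes the subtraction, and the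
            remaining \<open>n\<close> disappears because \<open>g\<close> has order
            \<open>n\<close>.\<close>
          have "g [^] m \<otimes> g [^] k y j = g [^] (k x j + n - k y j + k y j)"
            using g n by (simp add: m_def pow_mod_ord[OF g, unfolded n] nat_pow_mult)
          also have "k x j + n - k y j + k y j = k x j + n"
            using k[OF xy(2) j] by simp
          also have "g [^] (k x j + n) = g [^] k x j"
            using g n pow_ord_eq_1[OF g] by (simp add: nat_pow_mult[symmetric])
          finally have m: "g [^] m \<otimes> g [^] k y j = g [^] k x j" .
          have "x j = g [^] m \<otimes> g [^] k y j \<otimes> r j"
            using k[OF xy(1) j] m by simp
          also have "\<dots> = g [^] m \<otimes> y j"
            using k[OF xy(2) j] x_carrier[OF r(1) j] g by (simp add: m_assoc)
          finally have "x j \<otimes> inv y j = g [^] m"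
            using x_carrier[of x j] x_carrier[of y j] xy j g by (simp add: inv_solve_right')
          moreover have "g [^] m \<in> J"
            using contra j \<open>n > 0\<close> by (intro p(3)) (auto simp: m_def)
          ultimately show ?thesis by simp
        qed
        interpret P: group "group_power G N" by (simp add: is_group)
        have xyP: "x \<in> carrier (group_power G N)" "y \<in> carrier (group_power G N)"
          using xy A(1) by auto
        have "x \<otimes>\<^bsub>group_power G N\<^esub> inv\<^bsub>group_power G N\<^esub> y \<in> set_power J N"
          using J xyP by (simp add: is_group set_power_def)
        moreover have "x \<otimes>\<^bsub>group_power G N\<^esub> inv\<^bsub>group_power G N\<^esub> y \<in> difference_set (group_power G N) A"
          using xy by (auto simp: difference_set_def)
        ultimately have "x \<otimes>\<^bsub>group_power G N\<^esub> inv\<^bsub>group_power G N\<^esub> y = \<one>\<^bsub>group_power G N\<^esub>"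
          using A(2) by blast
        then have "x = y"
          using xyP by (metis P.inv_closed P.inv_equality P.inv_inv)
        with xy show False by simp
      qed
    qed (use \<open>finite A\<close> \<open>n > 0\<close> p k in auto)
  next
    case True
    then show ?thesis by (simp only: card.empty le0)
  qed
  have "phi x \<in> set_power (rcosets H) N" if "x \<in> A" for x
    unfolding phi_def set_power_def
    using x_carrier[OF that] rcosetsI[OF subgroup.subset[OF \<open>subgroup H G\<close>]]
    by (intro restrict_PiE_iff[THEN iffD2] ballI) simp
  then have "A = (\<Union>c\<in>set_power (rcosets H) N. {x \<in> A. phi x = c})"
    by blast
  then have "card A = card (\<Union>c\<in>set_power (rcosets H) N. {x \<in> A. phi x = c})"
    by (rule arg_cong)
  also have "\<dots> \<le> (\<Sum>c\<in>set_power (rcosets H) N. card {x \<in> A. phi x = c})"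
    by (rule card_UN_le[OF fin_cosets])
  also have "\<dots> \<le> card (set_power (rcosets H) N) *
      card {v \<in> set_power {..<n} N. Re (\<Prod>j<N. poly p (e n (v j))) \<ge> 1}"
    using sum_bounded_above[of "set_power (rcosets H) N", OF fibre] by simp
  also have "card (set_power (rcosets H) N) = card (rcosets H) ^ N"
    by (simp add: set_power_def card_PiE)
  finally show ?thesis .
qed

text \<open>The admissible sizes form a finite set, and it is nonempty: the singleton of the
  identity is admissible because \<open>\<one> \<in> J\<close>. So the maximum is a member.\<close>

lemma (in group) D_attained:
  assumes "finite (carrier G)" and "\<one> \<in> J"
  obtains A where "A \<subseteq> carrier (group_power G N)"
    and "difference_set (group_power G N) A \<inter> set_power J N = {\<one>\<^bsub>group_power G N\<^esub>}"
    and "card A = D G J N"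
proof -
  let ?P = "group_power G N"
  let ?S = "{card A | A. A \<subseteq> carrier ?P \<and> difference_set ?P A \<inter> set_power J N = {\<one>\<^bsub>?P\<^esub>}}"
  interpret P: group ?P by (simp add: is_group)
  have "finite (card ` Pow (carrier ?P))"
    using finite_group_power[OF assms(1)] by blast
  then have fin: "finite ?S" by (rule rev_finite_subset) auto
  have "\<one>\<^bsub>?P\<^esub> \<in> set_power J N"
    using assms(2) by (simp add: set_power_def)
  moreover have "difference_set ?P {\<one>\<^bsub>?P\<^esub>} = {\<one>\<^bsub>?P\<^esub> \<otimes>\<^bsub>?P\<^esub> inv\<^bsub>?P\<^esub> \<one>\<^bsub>?P\<^esub>}"
    unfolding difference_set_def by blast
  then have "difference_set ?P {\<one>\<^bsub>?P\<^esub>} = {\<one>\<^bsub>?P\<^esub>}"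
    by (simp only: P.inv_one P.r_one[OF P.one_closed])
  ultimately have "difference_set ?P {\<one>\<^bsub>?P\<^esub>} \<inter> set_power J N = {\<one>\<^bsub>?P\<^esub>}"
    by blast
  then have "card {\<one>\<^bsub>?P\<^esub>} \<in> ?S" using P.one_closed by blast
  then have "?S \<noteq> {}" by blast
  with fin have "D G J N \<in> ?S" unfolding D_def by (rule Max_in)
  then show ?thesis using that by auto
qed

section \<open>The bounds for \<open>D\<close>\<close>

theorem theorem1p5:
  fixes G :: "('a, 'b) monoid_scheme"
    and H J :: "'a set"
    and g :: 'a
    and n N :: nat
    and h :: "int poly"
  assumes "comm_group G" and "finite (carrier G)"
    and "g \<in> carrier G" and "H = generate G {g}" and "card H = n"
    and "J \<subseteq> H" and "J \<inter> (set_inv\<^bsub>G\<^esub> J) = {\<one>\<^bsub>G\<^esub>}"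
    and "poly h 0 = 1"
    and "\<And>k. Polynomial.coeff h k \<noteq> 0 \<Longrightarrow> k < n \<and> g [^]\<^bsub>G\<^esub> k \<in> J"
    and "N > 0"
  shows "D G J N \<le> subgroup_index G H ^ N *
           card {v \<in> set_power {..<n} N. Re (\<Prod>j<N. ceval h (e n (v j))) \<ge> 1} \<and>
         (h dvd Polynomial.monom 1 n - 1 \<longrightarrow>
           int (D G J N) \<le> (int (Coset.order G) - int (Polynomial.degree h) * int (subgroup_index G H)) ^ N)"
proof -
  interpret comm_group G by fact
  define p :: "complex poly" where "p = map_poly of_int h"
  define S where "S = {v \<in> set_power {..<n} N. Re (\<Prod>j<N. poly p (e n (v j))) \<ge> 1}"
  have coeff: "Polynomial.coeff p k = of_int (Polynomial.coeff h k)" for k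
    by (simp add: p_def coeff_map_poly)
  have deg: "Polynomial.degree p = Polynomial.degree h"
    by (simp add: p_def degree_map_poly)
  have "h \<noteq> 0" using assms(8) by auto
  \<comment> \<open>The leading coefficient is nonzero, so the support hypothesis applies at the
    degree itself.\<close>
  then have "Polynomial.degree h < n" using assms(9)[of "Polynomial.degree h"] by simp
  then have "n > 0" by simp
  have "\<one>\<^bsub>G\<^esub> \<in> J" using assms(7) by blast
  obtain A where A: "A \<subseteq> carrier (group_power G N)"
    "difference_set (group_power G N) A \<inter> set_power J N = {\<one>\<^bsub>group_power G N\<^esub>}"
    "card A = D G J N"
    by (rule D_attained[OF assms(2) \<open>\<one>\<^bsub>G\<^esub> \<in> J\<close>])
  have "card A \<le> card (rcosets\<^bsub>G\<^esub> H) ^ N * card S"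
    unfolding S_def
    by (rule card_difference_free_le[OF assms(2-5) A(1,2)])
      (use \<open>Polynomial.degree h < n\<close> assms(8,9) in \<open>auto simp: deg coeff poly_0_coeff_0\<close>)
  then have bound: "D G J N \<le> subgroup_index G H ^ N * card S"
    by (simp add: A(3) subgroup_index_def)
  have "int (D G J N) \<le> (int (Coset.order G) - int (Polynomial.degree h) * int (subgroup_index G H)) ^ N"
    if "h dvd Polynomial.monom 1 n - 1"
  proof -
    from that obtain q where q: "Polynomial.monom 1 n - 1 = h * q" by (elim dvdE)
    \<comment> \<open>The factorization over the integers is carried to the complex numbers
      coefficient by coefficient.\<close>
    have "Polynomial.monom 1 n - 1 = p * map_poly of_int q"
    proof (rule poly_eqI)
      fix k
      have "Polynomial.coeff (Polynomial.monom 1 n - 1) k =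
          (of_int (Polynomial.coeff (Polynomial.monom 1 n - 1) k) :: complex)"
        by simp
      also have "\<dots> = of_int (Polynomial.coeff (h * q) k)" by (simp only: q)
      also have "\<dots> = Polynomial.coeff (p * map_poly of_int q) k"
        by (simp add: coeff_mult coeff coeff_map_poly)
      finally show "Polynomial.coeff (Polynomial.monom 1 n - 1) k =
          Polynomial.coeff (p * map_poly of_int q) k" .
    qed
    then have "p dvd Polynomial.monom 1 n - 1" by simp
    define W where "W = {w \<in> {..<n}. poly p (e n w) \<noteq> 0}"
    have W: "card W + Polynomial.degree h \<le> n"
      using card_nonzero_at_roots_of_unity[OF \<open>n > 0\<close> \<open>p dvd _\<close>] by (simp add: W_def deg)
    \<comment> \<open>A product with real part at least 1 is nonzero, hence so is each of its
      factors.\<close>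
    have "S \<subseteq> set_power W N"
    proof
      fix v assume v: "v \<in> S"
      then have "Re (\<Prod>j<N. poly p (e n (v j))) \<noteq> 0" by (simp add: S_def)
      then have "(\<Prod>j<N. poly p (e n (v j))) \<noteq> 0" by (metis zero_complex.simps(1))
      then show "v \<in> set_power W N"
        using v by (auto simp: S_def W_def set_power_def PiE_iff)
    qed
    then have "card S \<le> card (set_power W N)"
      by (intro card_mono) (simp_all add: set_power_def W_def finite_PiE)
    also have "\<dots> = card W ^ N" by (simp add: set_power_def card_PiE)
    finally have "D G J N \<le> (subgroup_index G H * card W) ^ N"
      using bound by (simp add: power_mult_distrib) (meson le_trans mult_le_mono2)
    then have "int (D G J N) \<le> (int (subgroup_index G H) * int (card W)) ^ N"
      by (metis of_nat_le_iff of_nat_mult of_nat_power)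
    also have "\<dots> \<le> (int (subgroup_index G H) * (int n - int (Polynomial.degree h))) ^ N"
      using W by (intro power_mono mult_left_mono) auto
    also have "int (subgroup_index G H) * (int n - int (Polynomial.degree h)) =
        int (Coset.order G) - int (Polynomial.degree h) * int (subgroup_index G H)"
    \<comment> \<open>Lagrange's theorem: the index of \<open>H\<close> times \<open>n\<close> is
      the order of the group.\<close>
    proof -
      have "subgroup_index G H * n = Coset.order G"
        using lagrange[of H] generate_is_subgroup[of "{g}"] assms(3-5)
        by (simp add: subgroup_index_def)
      then show ?thesis by (simp add: algebra_simps flip: of_nat_mult)
    qed
    finally show ?thesis .
  qed
  moreover have "ceval h z = poly p z" for z by (simp add: ceval_def p_def)
  ultimately show ?thesis using bound by (simp add: S_def)
qed

end
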